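(* $RD$-WL and $L^\dagger$-WL are equally strong: any two featured graphs $(G,X_G)$ and $(H,X_H)$ are $RD$-WL indistinguishable if and only if they are $L^\dagger$-WL indistinguishable.
   Context: Graphs are finite, simple, undirected and unweighted. A featured graph $(G,X_G)$ is a graph with node features $X_G:V_G\to\mathbb{R}^d$. Double braces denote multisets. An RPE $\psi$ assigns each graph $G$ a map $\psi_G:V_G\times V_G\to\mathbb{R}^k$ such that $\psi_G=\psi_H\circ(\sigma\times\sigma)$ for every graph isomorphism $\sigma:V_G\to V_H$. $\psi$-WL: $\chi^{(0)}_{\psi_G}(v)=X_G(v)$ and $\chi^{(t+1)}_{\psi_G}(v)=\big(\chi^{(t)}_{\psi_G}(v),\{\!\{(\chi^{(t)}_{\psi_G}(u),\psi_G(v,u)):u\in V_G\}\!\}\big)$. Two featured graphs are $\psi$-WL indistinguishable if $\{\!\{\chi^{(t)}_{\psi_G}(v):v\in V_G\}\!\}=\{\!\{\chi^{(t)}_{\psi_H}(x):x\in V_H\}\!\}$ for all $t\ge0$. $L=D-A$ is the graph Laplacian ($A$ adjacency matrix, $D$ diagonal degree matrix), $L^\dagger$ its Moore–Penrose pseudoinverse, viewed as the RPE $(u,v)\mapsto L^\dagger(u,v)$. The resistance distance RPE is $RD(u,v)=(1_u-1_v)^TL^\dagger(1_u-1_v)=L^\dagger(u,u)+L^\dagger(v,v)-2L^\dagger(u,v)$, with $1_u$ the indicator vector of $u$. *)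

theory Defs
  imports "HOL-Analysis.Analysis" "HOL-Library.Multiset"
begin

section \<open>Graphs and their Laplacians\<close>

text \<open>
  The vertex set of a graph is the whole of a type of class \<^class>\<open>finite\<close>, so that
  vertex-indexed matrices are the matrices of HOL-Analysis.
\<close>

type_synonym 'v graph = "'v \<Rightarrow> 'v \<Rightarrow> bool"

definition simple_graph :: "'v::finite graph \<Rightarrow> bool" where
  "simple_graph G \<longleftrightarrow> symp G \<and> irreflp G"

definition adjacency_matrix :: "'v::finite graph \<Rightarrow> real ^ 'v ^ 'v" where
  "adjacency_matrix G = (\<chi> u v. if G u v then 1 else 0)"

definition degree_matrix :: "'v::finite graph \<Rightarrow> real ^ 'v ^ 'v" where
  "degree_matrix G = (\<chi> u v. if u = v then real (card {w. G u w}) else 0)"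

definition laplacian :: "'v::finite graph \<Rightarrow> real ^ 'v ^ 'v" where
  "laplacian G = degree_matrix G - adjacency_matrix G"

section \<open>The Moore--Penrose pseudoinverse\<close>

text \<open>
  The four Penrose conditions; \<open>pseudoinverse_exists_unique\<close> below shows that
  they determine exactly one matrix, so the definite description is meaningful.
\<close>

definition is_pseudoinverse :: "real ^ 'n ^ 'm \<Rightarrow> real ^ 'm ^ 'n \<Rightarrow> bool" where
  "is_pseudoinverse A P \<longleftrightarrow>
     A ** P ** A = A \<and> P ** A ** P = P \<and>
     transpose (A ** P) = A ** P \<and> transpose (P ** A) = P ** A"

definition pseudoinverse :: "real ^ 'n ^ 'm \<Rightarrow> real ^ 'm ^ 'n" where
  "pseudoinverse A = (THE P. is_pseudoinverse A P)"

lemma symmetric_matrixI: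
  fixes M :: "real ^ 'n ^ 'n"
  assumes "\<And>x y. (M *v x) \<bullet> y = (M *v x) \<bullet> (M *v y)"
  shows "transpose M = M"
proof -
  have "x \<bullet> (M *v y) = x \<bullet> (transpose M *v y)" for x y
  proof -
    have "x \<bullet> (M *v y) = (M *v y) \<bullet> (M *v x)"
      using assms[of y x] by (simp add: inner_commute)
    also have "\<dots> = (M *v x) \<bullet> y"
      using assms[of x y] by (simp add: inner_commute)
    also have "\<dots> = x \<bullet> (transpose M *v y)"
      by (metis dot_lmul_matrix transpose_matrix_vector inner_commute)
    finally show ?thesis .
  qed
  then have "M *v y = transpose M *v y" for y
    by (meson vector_eq_ldot)
  then show ?thesis
    by (simp add: matrix_eq)
qed

lemma is_pseudoinverse_unique:
  fixes A :: "real ^ 'n ^ 'm"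
  assumes P: "is_pseudoinverse A P" and Q: "is_pseudoinverse A Q"
  shows "P = Q"
proof -
  note P' = P[unfolded is_pseudoinverse_def] and Q' = Q[unfolded is_pseudoinverse_def]
  have "A ** P = (A ** Q) ** (A ** P)"
    using Q' by (metis matrix_mul_assoc)
  then have "A ** P = (A ** P) ** (A ** Q)"
    using P' Q' by (metis matrix_transpose_mul)
  then have 1: "A ** P = A ** Q"
    using P' by (metis matrix_mul_assoc)
  have "P ** A = (P ** A) ** (Q ** A)"
    using Q' by (metis matrix_mul_assoc)
  then have "P ** A = (Q ** A) ** (P ** A)"
    using P' Q' by (metis matrix_transpose_mul)
  then have 2: "P ** A = Q ** A"
    using P' by (metis matrix_mul_assoc)
  show ?thesis
    using P' Q' 1 2 by (metis matrix_mul_assoc)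
qed

lemma is_pseudoinverse_exists:
  fixes A :: "real ^ 'n ^ 'm"
  shows "\<exists>P. is_pseudoinverse A P"
proof -
  define K where "K = {k. A *v k = 0}"
  define R where "R = range ((*v) A)"
  have K: "subspace K"
    unfolding K_def by (auto simp: subspace_def matrix_vector_right_distrib matrix_vector_mult_scaleR)
  have R: "subspace R"
    unfolding R_def by (intro linear_subspace_image) auto
  define good where
    "good y w \<longleftrightarrow> (\<forall>k\<in>K. w \<bullet> k = 0) \<and> (\<forall>r\<in>R. (y - A *v w) \<bullet> r = 0)" for y w
  have ex: "\<exists>w. good y w" for y
  proof -
    obtain a z where a: "a \<in> span R" "\<And>r. r \<in> span R \<Longrightarrow> orthogonal z r" "y = a + z"
      using orthogonal_subspace_decomp_exists[of R y] by blast
    then obtain x where x: "a = A *v x"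
      using R by (auto simp: span_eq_iff[THEN iffD2] R_def)
    obtain k w where k: "k \<in> span K" "\<And>r. r \<in> span K \<Longrightarrow> orthogonal w r" "x = k + w"
      using orthogonal_subspace_decomp_exists[of K x] by blast
    have "A *v w = a"
      using k(1,3) K x by (simp add: span_eq_iff[THEN iffD2] K_def matrix_vector_right_distrib)
    then have "good y w"
      using a k by (auto simp: good_def orthogonal_def span_base)
    then show ?thesis by blast
  qed
  have unique: "w = w'" if "good y w" "good y w'" for y w w'
  proof -
    have "A *v (w - w') \<in> R"
      by (simp add: R_def)
    moreover have "A *v (w - w') = (y - A *v w') - (y - A *v w)"
      by (simp add: matrix_vector_mult_diff_distrib)
    ultimately have "(A *v (w - w')) \<bullet> (A *v (w - w')) = 0"
      using that by (metis good_def inner_diff_left diff_self)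
    then have "w - w' \<in> K"
      by (simp add: K_def)
    then have "(w - w') \<bullet> (w - w') = 0"
      using that unfolding good_def by (metis inner_diff_left diff_self)
    then show ?thesis by simp
  qed
  obtain f where f: "good y (f y)" for y
    using ex by metis
  have "linear f"
  proof (rule linearI)
    show "f (x + y) = f x + f y" for x y
    proof (rule unique[OF f])
      have "x + y - A *v (f x + f y) = (x - A *v f x) + (y - A *v f y)"
        by (simp add: matrix_vector_right_distrib)
      then show "good (x + y) (f x + f y)"
        using f[of x] f[of y] unfolding good_def by (metis add_0 inner_add_left)
    qed
    show "f (c *\<^sub>R x) = c *\<^sub>R f x" for c x
    proof (rule unique[OF f])
      have "c *\<^sub>R x - A *v (c *\<^sub>R f x) = c *\<^sub>R (x - A *v f x)"
        by (simp add: scaleR_diff_right matrix_vector_mult_scaleR)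
      then show "good (c *\<^sub>R x) (c *\<^sub>R f x)"
        using f[of x] by (simp add: good_def)
    qed
  qed
  define P where "P = matrix f"
  have P: "P *v y = f y" for y
    using \<open>linear f\<close> by (simp add: P_def matrix_works)
  have res: "(y - A *v (P *v y)) \<bullet> (A *v x) = 0" for x y
    using f[of y] by (simp add: P good_def R_def)
  have perp: "(P *v y) \<bullet> k = 0" if "A *v k = 0" for y k
    using f[of y] that by (simp add: P good_def K_def)
  have APA: "A *v (P *v (A *v x)) = A *v x" for x
  proof -
    have "(A *v x - A *v (P *v (A *v x))) \<bullet> (A *v (x - P *v (A *v x))) = 0"
      by (rule res)
    then show ?thesis
      by (simp add: matrix_vector_mult_diff_distrib)
  qed
  have PAP: "P *v (A *v (P *v y)) = P *v y" for y
  proof -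
    let ?d = "P *v (A *v (P *v y)) - P *v y"
    have "A *v ?d = 0"
      by (simp add: matrix_vector_mult_diff_distrib APA)
    then have "?d \<bullet> ?d = 0"
      by (subst inner_diff_left) (simp add: perp)
    then show ?thesis by simp
  qed
  have "transpose (A ** P) = A ** P"
  proof (rule symmetric_matrixI)
    show "((A ** P) *v x) \<bullet> y = ((A ** P) *v x) \<bullet> ((A ** P) *v y)" for x y
      using res[of y "P *v x"]
      by (simp add: matrix_vector_mul_assoc[symmetric] inner_diff_left inner_diff_right inner_commute)
  qed
  moreover have "transpose (P ** A) = P ** A"
  proof (rule symmetric_matrixI)
    show "((P ** A) *v x) \<bullet> y = ((P ** A) *v x) \<bullet> ((P ** A) *v y)" for x y
      using perp[of "y - P *v (A *v y)" "A *v x"]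
      by (simp add: matrix_vector_mul_assoc[symmetric] inner_diff_right
          matrix_vector_mult_diff_distrib APA)
  qed
  moreover have "A ** P ** A = A" "P ** A ** P = P"
    by (simp_all add: matrix_eq APA PAP flip: matrix_vector_mul_assoc)
  ultimately show ?thesis
    unfolding is_pseudoinverse_def by blast
qed

theorem pseudoinverse_exists_unique: "\<exists>!P. is_pseudoinverse A P"
  using is_pseudoinverse_exists is_pseudoinverse_unique by blast

lemma is_pseudoinverse_pseudoinverse: "is_pseudoinverse A (pseudoinverse A)"
  unfolding pseudoinverse_def by (rule theI') (rule pseudoinverse_exists_unique)

section \<open>Relative positional encodings\<close>

definition laplacian_pinv :: "'v::finite graph \<Rightarrow> 'v \<Rightarrow> 'v \<Rightarrow> real" where
  "laplacian_pinv G u v = pseudoinverse (laplacian G) $ u $ v"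

definition resistance_distance :: "'v::finite graph \<Rightarrow> 'v \<Rightarrow> 'v \<Rightarrow> real" where
  "resistance_distance G u v =
     (axis u 1 - axis v 1) \<bullet> (pseudoinverse (laplacian G) *v (axis u 1 - axis v 1))"

lemma resistance_distance_expand:
  "resistance_distance G u v =
     laplacian_pinv G u u + laplacian_pinv G v v - laplacian_pinv G u v - laplacian_pinv G v u"
  by (simp add: resistance_distance_def laplacian_pinv_def matrix_vector_mult_diff_distrib
      inner_diff_left inner_axis' matrix_vector_mult_basis column_def)

section \<open>The Weisfeiler--Leman refinement relative to an encoding\<close>

text \<open>
  The colours of round \<open>t\<close> are nested \<open>t\<close> deep, so a recursive datatype replaces a
  family of types indexed by \<open>t\<close>: \<open>Refine c M\<close> is the pair of \<open>c\<close> and \<open>M\<close>.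
\<close>

datatype ('x, 'k) colour =
    Init 'x
  | Refine "('x, 'k) colour" "(('x, 'k) colour \<times> 'k) multiset"

text \<open>Here \<open>\<psi>\<close> is the encoding already evaluated at the graph under consideration.\<close>

primrec wl_colour ::
  "('v::finite \<Rightarrow> 'v \<Rightarrow> 'k) \<Rightarrow> ('v \<Rightarrow> 'x) \<Rightarrow> nat \<Rightarrow> 'v \<Rightarrow> ('x, 'k) colour" where
  "wl_colour \<psi> X 0 = (\<lambda>v. Init (X v))"
| "wl_colour \<psi> X (Suc t) =
     (\<lambda>v. Refine (wl_colour \<psi> X t v)
            {# (wl_colour \<psi> X t u, \<psi> v u). u \<in># mset_set UNIV #})"

definition wl_indistinguishable ::
  "('v::finite \<Rightarrow> 'v \<Rightarrow> 'k) \<Rightarrow> ('v \<Rightarrow> 'x) \<Rightarrow> ('w::finite \<Rightarrow> 'w \<Rightarrow> 'k) \<Rightarrow> ('w \<Rightarrow> 'x) \<Rightarrow> bool" where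
  "wl_indistinguishable \<psi> X \<phi> Y \<longleftrightarrow>
     (\<forall>t. {# wl_colour \<psi> X t v. v \<in># mset_set UNIV #} =
          {# wl_colour \<phi> Y t x. x \<in># mset_set UNIV #})"

end

theory Submission
  imports Defs
begin

text \<open>
  Each encoding can be computed from the other one and from data of the two vertices that
  their colours of round 1 reveal, so either refinement simulates the other with a delay of one
  round. The data needed is the diagonal of \<open>L\<^sup>\<dagger>\<close>. As the rows of \<open>L\<^sup>\<dagger>\<close> sum to 0, the sum of
  \<open>RD(v,u)\<close> over \<open>u\<close> is \<open>n L\<^sup>\<dagger>(v,v) + tr L\<^sup>\<dagger>\<close>, and the trace is read off the total sum. In the other
  direction \<open>L\<^sup>\<dagger>(v,v)\<close> is the largest entry of its row, by a maximum principle.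
\<close>

section \<open>Simulation of refinements\<close>

primrec initial_feature :: "('x, 'k) colour \<Rightarrow> 'x" where
  "initial_feature (Init x) = x"
| "initial_feature (Refine c M) = initial_feature c"

primrec previous_colour :: "('x, 'k) colour \<Rightarrow> ('x, 'k) colour" where
  "previous_colour (Init x) = Init x"
| "previous_colour (Refine c M) = c"

primrec colour_neighbours :: "('x, 'k) colour \<Rightarrow> (('x, 'k) colour \<times> 'k) multiset" where
  "colour_neighbours (Init x) = {#}"
| "colour_neighbours (Refine c M) = M"

text \<open>Dropping the neighbour colours leaves a row of the encoding as a multiset, enough for
  the row sum and row maximum used later.\<close>

definition colour_labels :: "('x, 'k) colour \<Rightarrow> 'k multiset" where
  "colour_labels c = image_mset snd (colour_neighbours c)"

text \<open>
  \<open>translate_colour h t\<close> expects colours of round \<open>k + t\<close>, and \<open>h\<close> receives those of round \<open>k\<close>.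
\<close>

primrec translate_colour ::
  "(('x, 'k) colour \<Rightarrow> ('x, 'k) colour \<Rightarrow> 'k \<Rightarrow> 'l) \<Rightarrow> nat \<Rightarrow> ('x, 'k) colour \<Rightarrow> ('x, 'l) colour"
where
  "translate_colour h 0 = (\<lambda>c. Init (initial_feature c))"
| "translate_colour h (Suc t) =
     (\<lambda>c. Refine (translate_colour h t (previous_colour c))
        (image_mset (\<lambda>(d, p). (translate_colour h t d,
           h ((previous_colour ^^ t) (previous_colour c)) ((previous_colour ^^ t) d) p))
        (colour_neighbours c)))"

lemma initial_feature_wl_colour [simp]: "initial_feature (wl_colour \<psi> X t v) = X v"
  by (induction t) auto

lemma previous_colour_funpow_wl_colour [simp]:
  "(previous_colour ^^ t) (wl_colour \<psi> X (k + t) v) = wl_colour \<psi> X k v"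
  by (induction t) (auto simp: funpow_Suc_right simp del: funpow.simps)

lemma colour_labels_wl_colour:
  "colour_labels (wl_colour \<psi> X (Suc t) v) = {# \<psi> v u. u \<in># mset_set UNIV #}"
  by (simp add: colour_labels_def image_mset.compositionality o_def)

lemma sum_mset_colour_labels:
  fixes \<psi> :: "'v::finite \<Rightarrow> 'v \<Rightarrow> 'k::comm_monoid_add"
  shows "sum_mset (colour_labels (wl_colour \<psi> X (Suc t) v)) = (\<Sum>u\<in>UNIV. \<psi> v u)"
  by (simp only: colour_labels_wl_colour) (simp add: sum_unfold_sum_mset)

text \<open>A colour of round \<open>k + t\<close> holds, \<open>t\<close> layers down, the
  round-\<open>k\<close> colour of its vertex, and so do the round-\<open>k + t\<close> colours in
  the multiset one round later. Both arguments of \<open>h\<close> are thus recoverable when a label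
  is rewritten.\<close>

lemma wl_colour_translate:
  assumes "\<And>v u. \<psi>' v u = h (wl_colour \<psi> X k v) (wl_colour \<psi> X k u) (\<psi> v u)"
  shows "wl_colour \<psi>' X t v = translate_colour h t (wl_colour \<psi> X (k + t) v)"
proof (induction t arbitrary: v)
  case (Suc t)
  then show ?case
    by (simp add: assms image_mset.compositionality o_def)
qed simp

text \<open>One \<open>h\<close> serves both graphs, so one map carries the equal colour multisets
  of round \<open>k + t\<close> to those of round \<open>t\<close>. Any constant inside
  \<open>h\<close> must therefore agree on the two graphs.\<close>

lemma wl_indistinguishable_translate:
  assumes "wl_indistinguishable \<psi> X \<phi> Y"
    and \<psi>: "\<And>v u. \<psi>' v u = h (wl_colour \<psi> X k v) (wl_colour \<psi> X k u) (\<psi> v u)"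
    and \<phi>: "\<And>v u. \<phi>' v u = h (wl_colour \<phi> Y k v) (wl_colour \<phi> Y k u) (\<phi> v u)"
  shows "wl_indistinguishable \<psi>' X \<phi>' Y"
  unfolding wl_indistinguishable_def
proof
  fix t
  have "image_mset (translate_colour h t) {# wl_colour \<psi> X (k + t) v. v \<in># mset_set UNIV #} =
        image_mset (translate_colour h t) {# wl_colour \<phi> Y (k + t) x. x \<in># mset_set UNIV #}"
    using assms(1) by (simp add: wl_indistinguishable_def)
  moreover have "wl_colour \<psi>' X t = (\<lambda>v. translate_colour h t (wl_colour \<psi> X (k + t) v))"
    by (rule ext) (rule wl_colour_translate[where h = h, OF \<psi>])
  moreover have "wl_colour \<phi>' Y t = (\<lambda>v. translate_colour h t (wl_colour \<phi> Y (k + t) v))"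
    by (rule ext) (rule wl_colour_translate[where h = h, OF \<phi>])
  ultimately show "{# wl_colour \<psi>' X t v. v \<in># mset_set UNIV #} =
      {# wl_colour \<phi>' Y t x. x \<in># mset_set UNIV #}"
    by (simp add: image_mset.compositionality o_def)
qed

lemma wl_indistinguishable_card:
  fixes \<psi> :: "'v::finite \<Rightarrow> 'v \<Rightarrow> 'k" and \<phi> :: "'w::finite \<Rightarrow> 'w \<Rightarrow> 'k"
  assumes "wl_indistinguishable \<psi> X \<phi> Y"
  shows "CARD('v) = CARD('w)"
proof -
  have "size {# wl_colour \<psi> X 0 v. v \<in># mset_set UNIV #} =
        size {# wl_colour \<phi> Y 0 x. x \<in># mset_set UNIV #}"
    using assms by (metis wl_indistinguishable_def)
  then show ?thesis by simp
qed

text \<open>Each colour of round 1 determines its row sum, so the multiset of these colours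
  determines the total.\<close>

lemma wl_indistinguishable_total_sum:
  fixes \<psi> :: "'v::finite \<Rightarrow> 'v \<Rightarrow> 'k::comm_monoid_add" and \<phi> :: "'w::finite \<Rightarrow> 'w \<Rightarrow> 'k"
  assumes "wl_indistinguishable \<psi> X \<phi> Y"
  shows "(\<Sum>v\<in>UNIV. \<Sum>u\<in>UNIV. \<psi> v u) = (\<Sum>x\<in>UNIV. \<Sum>y\<in>UNIV. \<phi> x y)"
proof -
  have "(\<Sum>c\<in>#{# wl_colour \<psi> X (Suc 0) v. v \<in># mset_set UNIV #}. sum_mset (colour_labels c)) =
        (\<Sum>c\<in>#{# wl_colour \<phi> Y (Suc 0) x. x \<in># mset_set UNIV #}. sum_mset (colour_labels c))"
    using assms by (metis wl_indistinguishable_def)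
  then show ?thesis
    by (simp only: image_mset.compositionality o_def sum_mset_colour_labels)
       (simp only: sum_unfold_sum_mset)
qed

section \<open>The pseudoinverse of a symmetric matrix\<close>

lemma is_pseudoinverse_transpose:
  assumes "is_pseudoinverse A P"
  shows "is_pseudoinverse (transpose A) (transpose P)"
proof -
  have "transpose A ** transpose P ** transpose A = transpose (A ** P ** A)"
    and "transpose P ** transpose A ** transpose P = transpose (P ** A ** P)"
    by (simp_all add: matrix_transpose_mul matrix_mul_assoc)
  with assms show ?thesis
    by (simp add: is_pseudoinverse_def flip: matrix_transpose_mul)
qed

lemma transpose_pseudoinverse: "transpose (pseudoinverse A) = pseudoinverse (transpose A)"
  by (rule is_pseudoinverse_unique[OF is_pseudoinverse_transpose])
     (rule is_pseudoinverse_pseudoinverse)+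

lemma symmetric_matrix_inner:
  fixes A :: "real ^ 'n ^ 'n"
  assumes "transpose A = A"
  shows "x \<bullet> (A *v y) = (A *v x) \<bullet> y"
  using assms by (metis dot_lmul_matrix transpose_matrix_vector)

text \<open>With \<open>P\<close> the pseudoinverse, symmetry makes \<open>A\<close> and
  \<open>P\<close> commute, hence \<open>P = P A P = P P A\<close>.\<close>

lemma pseudoinverse_kernel:
  fixes A :: "real ^ 'n ^ 'n"
  assumes "transpose A = A" "A *v x = 0"
  shows "pseudoinverse A *v x = 0"
proof -
  let ?P = "pseudoinverse A"
  have *: "?P ** A ** ?P = ?P" "transpose (A ** ?P) = A ** ?P"
    using is_pseudoinverse_pseudoinverse[of A] by (auto simp: is_pseudoinverse_def)
  then have "A ** ?P = ?P ** A"
    using assms(1) transpose_pseudoinverse[of A] by (simp add: matrix_transpose_mul)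
  then have "?P *v x = ?P *v (?P *v (A *v x))"
    using * by (metis matrix_mul_assoc matrix_vector_mul_assoc)
  then show ?thesis
    using assms(2) by simp
qed

section \<open>The Dirichlet form and the maximum principle\<close>

lemma laplacian_mult_vector:
  "(laplacian G *v y) $ u = (\<Sum>v\<in>UNIV. of_bool (G u v) * (y $ u - y $ v))"
proof -
  have "(laplacian G *v y) $ u =
      (\<Sum>v\<in>UNIV. (if u = v then real (card {w. G u w}) * y $ u else 0) - of_bool (G u v) * y $ v)"
    unfolding laplacian_def degree_matrix_def adjacency_matrix_def matrix_vector_mult_def
    by (auto simp: algebra_simps intro!: sum.cong)
  also have "\<dots> = real (card {w. G u w}) * y $ u - (\<Sum>v\<in>UNIV. of_bool (G u v) * y $ v)"
    by (simp add: sum_subtractf)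
  also have "real (card {w. G u w}) = (\<Sum>v\<in>UNIV. of_bool (G u v))"
    by (simp add: of_bool_def sum.If_cases)
  finally show ?thesis
    by (simp add: right_diff_distrib sum_subtractf sum_distrib_right)
qed

lemma simple_graph_commute: "simple_graph G \<Longrightarrow> G u v = G v u"
  by (auto simp: simple_graph_def dest: sympD)

text \<open>Exchanging \<open>u\<close> and \<open>v\<close> turns the factor \<open>x $ u\<close>
  into \<open>- x $ v\<close>. Averaging both forms gives the symmetric sum over ordered pairs,
  whence the half.\<close>

lemma inner_laplacian:
  assumes "simple_graph G"
  shows "x \<bullet> (laplacian G *v y) =
    (\<Sum>u\<in>UNIV. \<Sum>v\<in>UNIV. of_bool (G u v) * ((x $ u - x $ v) * (y $ u - y $ v))) / 2"
proof -
  let ?s = "\<Sum>u\<in>UNIV. \<Sum>v\<in>UNIV. of_bool (G u v) * (x $ u * (y $ u - y $ v))"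
  have 1: "x \<bullet> (laplacian G *v y) = ?s"
    unfolding inner_vec_def laplacian_mult_vector
    by (intro sum.cong refl) (simp add: sum_distrib_left)
  have "?s = (\<Sum>u\<in>UNIV. \<Sum>v\<in>UNIV. of_bool (G v u) * (x $ v * (y $ v - y $ u)))"
    by (rule sum.swap)
  also have "\<dots> = (\<Sum>u\<in>UNIV. \<Sum>v\<in>UNIV. of_bool (G u v) * (- x $ v * (y $ u - y $ v)))"
    by (intro sum.cong refl) (simp add: simple_graph_commute[OF assms] algebra_simps)
  finally have 2: "2 * ?s = ?s + \<dots>" by linarith
  have "2 * ?s = (\<Sum>u\<in>UNIV. \<Sum>v\<in>UNIV. of_bool (G u v) * ((x $ u - x $ v) * (y $ u - y $ v)))"
    unfolding 2 sum.distrib[symmetric] by (intro sum.cong refl) (simp add: algebra_simps)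
  then show ?thesis using 1 by simp
qed

lemma transpose_laplacian: "simple_graph G \<Longrightarrow> transpose (laplacian G) = laplacian G"
  by (auto simp: vec_eq_iff transpose_def laplacian_def degree_matrix_def adjacency_matrix_def
      simple_graph_commute[of G])

text \<open>Zero energy is a vanishing sum of squares. The graph may be disconnected, so the kernel
  can exceed the constants.\<close>

lemma laplacian_kernel_iff:
  assumes "simple_graph G"
  shows "laplacian G *v x = 0 \<longleftrightarrow> (\<forall>u v. G u v \<longrightarrow> x $ u = x $ v)"
proof
  assume "laplacian G *v x = 0"
  then have "(\<Sum>u\<in>UNIV. \<Sum>v\<in>UNIV. of_bool (G u v) * ((x $ u - x $ v) * (x $ u - x $ v))) = 0"
    using inner_laplacian[OF assms, of x x] by simp
  then show "\<forall>u v. G u v \<longrightarrow> x $ u = x $ v"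
    by (auto simp: sum_nonneg_eq_0_iff sum_nonneg)
next
  assume "\<forall>u v. G u v \<longrightarrow> x $ u = x $ v"
  then show "laplacian G *v x = 0"
    by (auto simp: vec_eq_iff laplacian_mult_vector intro!: sum.neutral)
qed

lemma laplacian_energy_nonneg: "simple_graph G \<Longrightarrow> 0 \<le> x \<bullet> (laplacian G *v x)"
  by (simp add: inner_laplacian sum_nonneg)

lemma laplacian_energy_eq_0_imp_kernel:
  assumes "simple_graph G" "x \<bullet> (laplacian G *v x) = 0"
  shows "laplacian G *v x = 0"
proof -
  have "(\<Sum>u\<in>UNIV. \<Sum>v\<in>UNIV. of_bool (G u v) * ((x $ u - x $ v) * (x $ u - x $ v))) = 0"
    using assms by (simp add: inner_laplacian)
  then show ?thesis
    by (auto simp: laplacian_kernel_iff[OF assms(1)] sum_nonneg_eq_0_iff sum_nonneg)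
qed

text \<open>
  \<open>1 - L L\<^sup>\<dagger>\<close> is the orthogonal projection to the kernel of \<open>L\<close>. The kernel is closed under
  taking negative parts, which makes the projection positive.
\<close>

lemma kernel_projection_nonneg:
  fixes G :: "'v::finite graph"
  assumes G: "simple_graph G" and g: "\<And>u. 0 \<le> g $ u"
  shows "(laplacian G *v (pseudoinverse (laplacian G) *v g)) $ v \<le> g $ v"
proof -
  let ?L = "laplacian G" let ?P = "pseudoinverse ?L"
  define k where "k = g - ?L *v (?P *v g)"
  define k' where "k' = (\<chi> u. max (- k $ u) 0)"
  have "?L ** ?P ** ?L = ?L" and sym: "transpose (?L ** ?P) = ?L ** ?P"
    using is_pseudoinverse_pseudoinverse[of ?L] by (auto simp: is_pseudoinverse_def)
  moreover have "?L ** ?P = ?P ** ?L"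
    using sym transpose_laplacian[OF G] transpose_pseudoinverse[of ?L]
    by (simp add: matrix_transpose_mul)
  ultimately have "?L ** (?L ** ?P) = ?L"
    by (simp add: matrix_mul_assoc)
  then have "?L *v k = 0"
    by (simp add: k_def matrix_vector_mult_diff_distrib matrix_vector_mul_assoc)
  then have "?L *v k' = 0"
    by (auto simp: laplacian_kernel_iff[OF G] k'_def)
  \<comment> \<open>A kernel vector is orthogonal to the range of \<open>L\<close>, so the part
    \<open>L P g\<close> of \<open>k\<close> contributes nothing.\<close>
  then have "k' \<bullet> k = k' \<bullet> g"
    using symmetric_matrix_inner[OF transpose_laplacian[OF G], of k' "?P *v g"]
    by (simp add: k_def inner_diff_right)
  also have "\<dots> \<ge> 0"
    using g by (auto simp: inner_vec_def k'_def intro!: sum_nonneg mult_nonneg_nonneg)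
  finally have "0 \<le> k' \<bullet> k" .
  moreover have "k' \<bullet> k = - (k' \<bullet> k')"
    by (auto simp: inner_vec_def k'_def max_def simp flip: sum_negf intro!: sum.cong)
  ultimately have "k' = 0"
    by (metis inner_ge_zero inner_eq_zero_iff neg_0_le_iff_le order_antisym)
  then have "max (- k $ v) 0 = 0"
    by (metis k'_def vec_lambda_beta zero_index)
  then show ?thesis
    by (simp add: k_def max_def split: if_splits)
qed

lemma laplacian_pinv_commute: "simple_graph G \<Longrightarrow> laplacian_pinv G u v = laplacian_pinv G v u"
  using transpose_pseudoinverse[of "laplacian G"] transpose_laplacian[of G]
  by (simp add: laplacian_pinv_def transpose_def vec_eq_iff)

text \<open>The all-ones vector lies in the kernel of \<open>L\<close>, hence in that of its
  pseudoinverse.\<close>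

lemma laplacian_pinv_row_sum:
  assumes "simple_graph G"
  shows "(\<Sum>u\<in>UNIV. laplacian_pinv G v u) = 0"
proof -
  have "pseudoinverse (laplacian G) *v 1 = 0"
    by (rule pseudoinverse_kernel)
       (simp_all add: assms transpose_laplacian laplacian_kernel_iff)
  then show ?thesis
    by (simp add: laplacian_pinv_def vec_eq_iff matrix_vector_mult_def)
qed

text \<open>
  The excess \<open>g\<close> of the potential \<open>f\<close> over its value at the source \<open>v\<close> has energy at most 0, so
  it lies in the kernel, to which \<open>f\<close> is orthogonal.
\<close>

lemma laplacian_pinv_le_diag:
  fixes G :: "'v::finite graph"
  assumes G: "simple_graph G"
  shows "laplacian_pinv G v u \<le> laplacian_pinv G v v"
proof -
  let ?L = "laplacian G" let ?P = "pseudoinverse ?L"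
  define f where "f = ?P *v axis v 1"
  have f: "f $ u = laplacian_pinv G v u" for u
    using laplacian_pinv_commute[OF G, of u v]
    by (simp add: f_def laplacian_pinv_def matrix_vector_mult_basis column_def)
  define m where "m = f $ v"
  define g where "g = (\<chi> u. max (f $ u - m) 0)"
  have symL: "transpose ?L = ?L" and symP: "transpose ?P = ?P"
    using transpose_laplacian[OF G] transpose_pseudoinverse[of ?L] by simp_all
  have PLP: "?P ** ?L ** ?P = ?P" and symLP: "transpose (?L ** ?P) = ?L ** ?P"
    using is_pseudoinverse_pseudoinverse[of ?L] by (auto simp: is_pseudoinverse_def)
  \<comment> \<open>The diagonal entry \<open>m\<close> is the energy of \<open>f\<close>; its sign
    is needed in the final comparison of \<open>g\<close> with \<open>f\<close>.\<close>
  have "m = axis v 1 \<bullet> (?P *v axis v 1)"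
    by (simp add: m_def f_def inner_axis')
  also have "\<dots> = axis v 1 \<bullet> (?P *v (?L *v (?P *v axis v 1)))"
    by (simp add: matrix_vector_mul_assoc matrix_mul_assoc PLP)
  also have "\<dots> = f \<bullet> (?L *v f)"
    by (simp add: symmetric_matrix_inner[OF symP] f_def)
  finally have m: "0 \<le> m"
    using laplacian_energy_nonneg[OF G] by simp
  have "g \<bullet> (?L *v g) \<le> g \<bullet> (?L *v f)"
  proof -
    \<comment> \<open>Truncation is monotone and 1-Lipschitz: the truncated difference has no sign
      opposite to \<open>a - b\<close> and is no larger in size.\<close>
    have "(max (a - m) 0 - max (b - m) 0) * (max (a - m) 0 - max (b - m) 0) \<le>
        (max (a - m) 0 - max (b - m) 0) * (a - b)" for a b :: real
      using mult_nonneg_nonneg[of "a - m" "m - b"] mult_nonneg_nonneg[of "b - m" "m - a"]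
      by (auto simp: max_def algebra_simps)
    then show ?thesis
      unfolding inner_laplacian[OF G] g_def
      by (intro divide_right_mono sum_mono mult_left_mono[OF _ zero_less_eq_of_bool])
         (simp_all only: vec_lambda_beta zero_le_numeral)
  qed
  \<comment> \<open>Since \<open>L f = L P e_v\<close> with \<open>L P\<close> symmetric, the
    pairing is the projection of \<open>g\<close> evaluated at the source.\<close>
  also have "g \<bullet> (?L *v f) = (?L *v (?P *v g)) $ v"
    using symmetric_matrix_inner[OF symLP, of g "axis v 1"]
    by (simp add: f_def matrix_vector_mul_assoc inner_axis)
  also have "\<dots> \<le> g $ v"
    by (rule kernel_projection_nonneg[OF G]) (simp add: g_def)
  also have "g $ v = 0"
    by (simp add: g_def m_def)
  finally have "g \<bullet> (?L *v g) = 0"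
    using laplacian_energy_nonneg[OF G, of g] by simp
  then have "?L *v g = 0"
    by (rule laplacian_energy_eq_0_imp_kernel[OF G])
  then have "g \<bullet> f = 0"
    by (simp add: f_def symmetric_matrix_inner[OF symP] pseudoinverse_kernel[OF symL])
  \<comment> \<open>Where \<open>g\<close> is positive, \<open>f = g + m\<close> with
    \<open>m\<close> nonnegative.\<close>
  moreover have "g \<bullet> g \<le> g \<bullet> f"
    unfolding inner_vec_def by (rule sum_mono) (use m in \<open>simp add: g_def max_def\<close>)
  ultimately have "g = 0"
    by (metis inner_ge_zero inner_eq_zero_iff order_antisym)
  then have "max (f $ u - m) 0 = 0"
    by (metis g_def vec_lambda_beta zero_index)
  then show ?thesis
    using f by (simp add: m_def max_def split: if_splits)
qed

section \<open>The diagonal of the pseudoinverse\<close>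

text \<open>A row multiset does not mark its diagonal entry; the maximum singles out the
  value.\<close>

lemma Max_laplacian_pinv_row:
  "simple_graph G \<Longrightarrow> Max (range (laplacian_pinv G v)) = laplacian_pinv G v v"
  by (rule Max_eqI) (auto simp: laplacian_pinv_le_diag)

lemma resistance_distance_eq:
  "simple_graph G \<Longrightarrow> resistance_distance G u v =
     laplacian_pinv G u u + laplacian_pinv G v v - 2 * laplacian_pinv G u v"
  using laplacian_pinv_commute[of G u v] by (simp add: resistance_distance_expand)

lemma resistance_distance_row_sum:
  fixes G :: "'v::finite graph"
  assumes "simple_graph G"
  shows "(\<Sum>u\<in>UNIV. resistance_distance G v u) =
    real CARD('v) * laplacian_pinv G v v + (\<Sum>u\<in>UNIV. laplacian_pinv G u u)"
  by (simp add: resistance_distance_eq[OF assms] sum_subtractf sum.distrib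
      laplacian_pinv_row_sum[OF assms] flip: sum_distrib_left)

text \<open>Adding up the row sums gives \<open>2 n\<close> times the trace; substituting this trace
  into one row sum and solving yields the formula.\<close>

lemma laplacian_pinv_diag_eq:
  fixes G :: "'v::finite graph"
  assumes "simple_graph G"
  shows "laplacian_pinv G v v = ((\<Sum>u\<in>UNIV. resistance_distance G v u)
    - (\<Sum>u\<in>UNIV. \<Sum>w\<in>UNIV. resistance_distance G u w) / (2 * real CARD('v))) / real CARD('v)"
  by (simp add: resistance_distance_row_sum[OF assms] sum.distrib field_simps
      flip: sum_distrib_left)

theorem corollary4p3:
  fixes G :: "'v::finite graph" and H :: "'w::finite graph"
    and X\<^sub>G :: "'v \<Rightarrow> real ^ 'd" and X\<^sub>H :: "'w \<Rightarrow> real ^ 'd"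
  assumes "simple_graph G" and "simple_graph H"
  shows "wl_indistinguishable (resistance_distance G) X\<^sub>G (resistance_distance H) X\<^sub>H \<longleftrightarrow>
         wl_indistinguishable (laplacian_pinv G) X\<^sub>G (laplacian_pinv H) X\<^sub>H"
proof
  assume RD: "wl_indistinguishable (resistance_distance G) X\<^sub>G (resistance_distance H) X\<^sub>H"
  \<comment> \<open>\<open>n\<close> and \<open>s\<close> are taken from \<open>G\<close> but agree
    with those of \<open>H\<close>, so \<open>d\<close> is one function for both graphs.\<close>
  define n where "n = real CARD('v)"
  define s where "s = (\<Sum>u\<in>UNIV. \<Sum>w\<in>UNIV. resistance_distance G u w)"
  define d :: "(real ^ 'd, real) colour \<Rightarrow> real"
    where "d c = (sum_mset (colour_labels c) - s / (2 * n)) / n" for c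
  have n: "n = real CARD('w)"
    using wl_indistinguishable_card[OF RD] by (simp add: n_def)
  have s: "s = (\<Sum>u\<in>UNIV. \<Sum>w\<in>UNIV. resistance_distance H u w)"
    unfolding s_def by (rule wl_indistinguishable_total_sum[OF RD])
  have dG: "d (wl_colour (resistance_distance G) X\<^sub>G (Suc 0) v) = laplacian_pinv G v v" for v
    unfolding d_def sum_mset_colour_labels laplacian_pinv_diag_eq[OF assms(1)]
    by (simp only: s_def n_def)
  have dH: "d (wl_colour (resistance_distance H) X\<^sub>H (Suc 0) v) = laplacian_pinv H v v" for v
    unfolding d_def sum_mset_colour_labels laplacian_pinv_diag_eq[OF assms(2)]
    by (simp only: s n)
  \<comment> \<open>Round 1 is the first whose colours contain a row; \<open>h\<close> solves
    \<open>resistance_distance_eq\<close> for the mixed entry.\<close>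
  show "wl_indistinguishable (laplacian_pinv G) X\<^sub>G (laplacian_pinv H) X\<^sub>H"
    by (rule wl_indistinguishable_translate[OF RD,
          where k = "Suc 0" and h = "\<lambda>c c' p. (d c + d c' - p) / 2"])
       (simp_all only: dG dH, simp_all add: resistance_distance_eq assms)
next
  assume L: "wl_indistinguishable (laplacian_pinv G) X\<^sub>G (laplacian_pinv H) X\<^sub>H"
  define d :: "(real ^ 'd, real) colour \<Rightarrow> real"
    where "d c = Max (set_mset (colour_labels c))" for c
  have dG: "d (wl_colour (laplacian_pinv G) X\<^sub>G (Suc 0) v) = laplacian_pinv G v v" for v
    unfolding d_def colour_labels_wl_colour by (simp add: Max_laplacian_pinv_row assms)
  have dH: "d (wl_colour (laplacian_pinv H) X\<^sub>H (Suc 0) v) = laplacian_pinv H v v" for v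
    unfolding d_def colour_labels_wl_colour by (simp add: Max_laplacian_pinv_row assms)
  show "wl_indistinguishable (resistance_distance G) X\<^sub>G (resistance_distance H) X\<^sub>H"
    by (rule wl_indistinguishable_translate[OF L,
          where k = "Suc 0" and h = "\<lambda>c c' p. d c + d c' - 2 * p"])
       (simp_all only: dG dH, simp_all add: resistance_distance_eq assms)
qed

end
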